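(* Let $q$ be an odd prime power, $n=2t$ with $t\geq 5$, let $\sigma,\theta$ be any generators of $\mathrm{Gal}(\mathbb{F}_{q^n}/\mathbb{F}_q)$, and let $h\in\mathbb{F}_{q^n}$ be any element with $\sigma^t(h)h=-1$. Then the $2$-dimensional Gabidulin code $\mathcal{G}_{2,\theta}=\langle x,x^{\theta}\rangle_{\mathbb{F}_{q^n}}$ is not equivalent to $\mathcal{C}_{h,t,\sigma}$.
   Context: For a generator $\sigma$ of $\mathrm{Gal}(\mathbb{F}_{q^n}/\mathbb{F}_q)$, $\mathcal{L}_{n,q}$ denotes the ring (under addition and composition) of $\sigma$-polynomials $f(x)=\sum_{i=0}^{n-1}f_ix^{\sigma^i}$, $f_i\in\mathbb{F}_{q^n}$, each identified with the $\mathbb{F}_q$-endomorphism $\alpha\mapsto\sum_i f_i\sigma^i(\alpha)$ of $\mathbb{F}_{q^n}$; thus $\mathcal{L}_{n,q}\cong\mathrm{End}_{\mathbb{F}_q}(\mathbb{F}_{q^n})$, independently of $\sigma$. $\langle\cdot\rangle_{\mathbb{F}_{q^n}}$ denotes the span with respect to left multiplication by scalars of $\mathbb{F}_{q^n}$. A rank-metric code is a subset of $\mathcal{L}_{n,q}$. Two rank-metric codes $\mathcal{C}_1,\mathcal{C}_2\subseteq\mathcal{L}_{n,q}$ are equivalent if there exist invertible $f_1,f_2\in\mathcal{L}_{n,q}$ and a field automorphism $\rho\in\mathrm{Aut}(\mathbb{F}_{q^n})$ with $\mathcal{C}_1=\{f_1\circ g^{\rho}\circ f_2: g\in\mathcal{C}_2\}$,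 where $g^{\rho}(x)=\sum_i\rho(a_i)x^{\sigma^i}$ if $g(x)=\sum_i a_ix^{\sigma^i}$. $\mathcal{C}_{h,t,\sigma}=\langle x,\psi_{h,t,\sigma}(x)\rangle_{\mathbb{F}_{q^n}}$, where $\psi_{h,t,\sigma}(x)=x^{\sigma}+x^{\sigma^{t-1}}+h\sigma(h)x^{\sigma^{t+1}}+h\sigma^{-1}(h^{-1})x^{\sigma^{2t-1}}$. *)

theory Defs
  imports
    "HOL-Number_Theory.Prime_Powers"
    "HOL-Library.Function_Algebras"
begin

definition is_subfield :: "'a::field set \<Rightarrow> bool" where
  "is_subfield K \<longleftrightarrow> 0 \<in> K \<and> 1 \<in> K \<and>
     (\<forall>x\<in>K. \<forall>y\<in>K. x - y \<in> K \<and> x * y \<in> K) \<and> (\<forall>x\<in>K. inverse x \<in> K)"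

definition field_aut :: "('a::field \<Rightarrow> 'a) \<Rightarrow> bool" where
  "field_aut \<rho> \<longleftrightarrow> bij \<rho> \<and> \<rho> 1 = 1 \<and>
     (\<forall>x y. \<rho> (x + y) = \<rho> x + \<rho> y) \<and> (\<forall>x y. \<rho> (x * y) = \<rho> x * \<rho> y)"

text \<open>The Galois group of the whole type over a subfield \<open>K\<close>.\<close>

definition Gal :: "'a::field set \<Rightarrow> ('a \<Rightarrow> 'a) set" where
  "Gal K = {\<sigma>. field_aut \<sigma> \<and> (\<forall>x\<in>K. \<sigma> x = x)}"

text \<open>Non-negative powers suffice, since the group is used only for finite fields and is
  therefore finite.\<close>

definition Gal_generator :: "'a::field set \<Rightarrow> ('a \<Rightarrow> 'a) \<Rightarrow> bool" where
  "Gal_generator K \<sigma> \<longleftrightarrow> \<sigma> \<in> Gal K \<and> (\<forall>\<tau>\<in>Gal K. \<exists>i::nat. \<tau> = \<sigma> ^^ i)"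

text \<open>The endomorphism given by the \<open>\<sigma>\<close>-polynomial with coefficients \<open>a 0, \<dots>, a (n - 1)\<close>;
  here \<open>x\<close> raised to the exponent \<open>\<sigma>\<^sup>i\<close> means \<open>(\<sigma> ^^ i) x\<close>. Values of \<open>a\<close> at indices
  \<open>\<ge> n\<close> are ignored.\<close>

definition sigma_poly :: "('a::field \<Rightarrow> 'a) \<Rightarrow> nat \<Rightarrow> (nat \<Rightarrow> 'a) \<Rightarrow> 'a \<Rightarrow> 'a" where
  "sigma_poly \<sigma> n a = (\<lambda>x. \<Sum>i<n. a i * (\<sigma> ^^ i) x)"

definition sigma_polys :: "('a::field \<Rightarrow> 'a) \<Rightarrow> nat \<Rightarrow> ('a \<Rightarrow> 'a) set" where
  "sigma_polys \<sigma> n = range (sigma_poly \<sigma> n)"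

definition invertible_sigma_poly :: "('a::field \<Rightarrow> 'a) \<Rightarrow> nat \<Rightarrow> ('a \<Rightarrow> 'a) \<Rightarrow> bool" where
  "invertible_sigma_poly \<sigma> n f \<longleftrightarrow>
     f \<in> sigma_polys \<sigma> n \<and> (\<exists>g\<in>sigma_polys \<sigma> n. f \<circ> g = id \<and> g \<circ> f = id)"

text \<open>Equivalence of codes \<open>C\<^sub>1, C\<^sub>2 \<subseteq> sigma_polys \<sigma> n\<close>. An element of \<open>C\<^sub>2\<close> is written as
  \<open>sigma_poly \<sigma> n a\<close>, and \<open>\<rho>\<close> acts on its coefficients. When \<open>\<sigma>\<close> generates a Galois group of
  order \<open>n\<close>, its powers \<open>\<sigma> ^^ i\<close> with \<open>i < n\<close> are linearly independent, so the coefficients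
  below \<open>n\<close> are uniquely determined.\<close>

definition code_equiv ::
    "('a::field \<Rightarrow> 'a) \<Rightarrow> nat \<Rightarrow> ('a \<Rightarrow> 'a) set \<Rightarrow> ('a \<Rightarrow> 'a) set \<Rightarrow> bool" where
  "code_equiv \<sigma> n C\<^sub>1 C\<^sub>2 \<longleftrightarrow>
     (\<exists>f\<^sub>1 f\<^sub>2 \<rho>. invertible_sigma_poly \<sigma> n f\<^sub>1 \<and> invertible_sigma_poly \<sigma> n f\<^sub>2 \<and> field_aut \<rho> \<and>
        C\<^sub>1 = {f\<^sub>1 \<circ> sigma_poly \<sigma> n (\<rho> \<circ> a) \<circ> f\<^sub>2 | a. sigma_poly \<sigma> n a \<in> C\<^sub>2})"

definition left_scale :: "'a::field \<Rightarrow> ('a \<Rightarrow> 'a) \<Rightarrow> 'a \<Rightarrow> 'a" where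
  "left_scale c f = (\<lambda>x. c * f x)"

definition left_span :: "('a::field \<Rightarrow> 'a) set \<Rightarrow> ('a \<Rightarrow> 'a) set" where
  "left_span = module.span left_scale"

lemma vector_space_left_scale: "vector_space (left_scale :: 'a::field \<Rightarrow> _)"
  by unfold_locales (auto simp: left_scale_def fun_eq_iff algebra_simps)

lemma left_span_pair:
  "left_span {f, g} = {(\<lambda>x. a * f x + b * g x) | a b. True}"
proof -
  interpret vector_space "left_scale :: 'a \<Rightarrow> _"
    by (rule vector_space_left_scale)
  show ?thesis
    by (auto simp: left_span_def span_insert left_scale_def fun_eq_iff diff_eq_eq add.commute)
qed

definition gabidulin2 :: "('a::field \<Rightarrow> 'a) \<Rightarrow> ('a \<Rightarrow> 'a) set" where
  "gabidulin2 \<theta> = left_span {\<lambda>x. x, \<theta>}"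

definition psi :: "'a::field \<Rightarrow> nat \<Rightarrow> ('a \<Rightarrow> 'a) \<Rightarrow> 'a \<Rightarrow> 'a" where
  "psi h t \<sigma> = (\<lambda>x. \<sigma> x + (\<sigma> ^^ (t - 1)) x + h * \<sigma> h * (\<sigma> ^^ (t + 1)) x
                   + h * inv \<sigma> (inverse h) * (\<sigma> ^^ (2 * t - 1)) x)"

definition code_h :: "'a::field \<Rightarrow> nat \<Rightarrow> ('a \<Rightarrow> 'a) \<Rightarrow> ('a \<Rightarrow> 'a) set" where
  "code_h h t \<sigma> = left_span {\<lambda>x. x, psi h t \<sigma>}"

end

(* The right idealiser {f. C o f <= C} of a code C containing x lies inside C, and equivalent
   codes have conjugate right idealisers. That of a Gabidulin code contains all q^(2t) scalar
   multiplications. For the code spanned by x and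
     P = x^s + x^(s^(t-1)) + c x^(s^(t+1)) + d x^(s^(2t-1)),  c nonzero, s = sigma,
   comparing the coefficients at t - 1 and t + 1 in P o (alpha x + beta P) = alpha' x + beta' P
   shows that s^2 fixes alpha, and the coefficient at 2 shows that the ratio of any two
   nonzero admissible beta is fixed by s^t. So its right idealiser has at most
   q^2 q^t < q^(2t) elements. *)
theory Submission
  imports
    Defs
    "HOL-Number_Theory.Residues"
    "HOL-Computational_Algebra.Polynomial"
begin

section \<open>Finite fields and their automorphisms\<close>

lemma field_autD:
  assumes "field_aut \<rho>"
  shows "bij \<rho>" "\<rho> 1 = 1" "\<rho> 0 = 0" "\<rho> (x + y) = \<rho> x + \<rho> y" "\<rho> (x * y) = \<rho> x * \<rho> y"
    "\<rho> (- x) = - \<rho> x" "\<rho> (x - y) = \<rho> x - \<rho> y" "\<rho> x = 0 \<longleftrightarrow> x = 0" "inj \<rho>"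
    "\<rho> (inverse x) = inverse (\<rho> x)" "\<rho> (x / y) = \<rho> x / \<rho> y"
proof -
  show *: "bij \<rho>" "\<rho> 1 = 1" and add: "\<And>x y. \<rho> (x + y) = \<rho> x + \<rho> y"
    and mult: "\<And>x y. \<rho> (x * y) = \<rho> x * \<rho> y"
    using assms by (auto simp: field_aut_def)
  show inj: "inj \<rho>" using * by (simp add: bij_is_inj)
  show zero: "\<rho> 0 = 0" using add[of 0 0] by (metis add_cancel_right_right add_0)
  show minus: "\<rho> (- x) = - \<rho> x" for x using add[of x "- x"] zero by (simp add: eq_neg_iff_add_eq_0 add.commute)
  show "\<rho> (x - y) = \<rho> x - \<rho> y" using add[of x "- y"] minus by simp
  show zero_iff: "\<rho> x = 0 \<longleftrightarrow> x = 0" for x using inj zero by (metis injD)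
  show inv: "\<rho> (inverse x) = inverse (\<rho> x)" for x
  proof (cases "x = 0")
    case False
    then have "\<rho> x * \<rho> (inverse x) = 1" using mult[of x "inverse x"] * by simp
    then show ?thesis by (metis inverse_unique)
  qed (simp add: zero)
  show "\<rho> (x / y) = \<rho> x / \<rho> y" using mult inv by (simp add: divide_inverse)
qed

lemma field_aut_funpow:
  assumes "field_aut \<rho>"
  shows "field_aut (\<rho> ^^ i)"
proof (induction i)
  case (Suc i)
  then show ?case using assms bij_fn[of \<rho> "Suc i"] by (simp add: field_aut_def comp_def)
qed (simp add: field_aut_def bij_id[unfolded id_def])

section \<open>Linear independence of characters\<close>

text \<open>Artin's argument, by induction on \<open>S\<close>: subtracting
  \<open>\<chi>\<^sub>0 y\<close> times the relation at \<open>x\<close> from the relation at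
  \<open>y * x\<close> removes \<open>\<chi>\<^sub>0\<close>, so every other
  \<open>a \<eta> * (\<eta> y - \<chi>\<^sub>0 y)\<close> vanishes, and \<open>y\<close> can be
  chosen to separate \<open>\<eta>\<close> from \<open>\<chi>\<^sub>0\<close>. The value 1 at 1 then
  kills the coefficient of \<open>\<chi>\<^sub>0\<close>.\<close>

lemma dedekind_independence:
  fixes \<chi> :: "'b::monoid_mult \<Rightarrow> 'a::field"
  assumes "finite S"
    and "\<And>\<chi>. \<chi> \<in> S \<Longrightarrow> \<chi> 1 = 1"
    and "\<And>\<chi> x y. \<chi> \<in> S \<Longrightarrow> \<chi> (x * y) = \<chi> x * \<chi> y"
    and "\<And>x. (\<Sum>\<chi>\<in>S. a \<chi> * \<chi> x) = 0"
    and "\<chi> \<in> S"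
  shows "a \<chi> = 0"
  using assms
proof (induction S arbitrary: a \<chi> rule: finite_induct)
  case empty
  then show ?case by simp
next
  case (insert \<chi>\<^sub>0 S)
  have one: "\<eta> 1 = 1" and mult: "\<eta> (x * y) = \<eta> x * \<eta> y" if "\<eta> \<in> insert \<chi>\<^sub>0 S" for \<eta> x y
    using that insert.prems by auto
  have rel: "a \<chi>\<^sub>0 * \<chi>\<^sub>0 x + (\<Sum>\<eta>\<in>S. a \<eta> * \<eta> x) = 0" for x
    using insert.prems(3)[of x] insert.hyps by simp
  have zero: "a \<eta> = 0" if "\<eta> \<in> S" for \<eta>
  proof -
    have "\<eta> \<noteq> \<chi>\<^sub>0" using that insert.hyps by auto
    then obtain y where y: "\<eta> y \<noteq> \<chi>\<^sub>0 y" by auto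
    have "a \<eta> * (\<eta> y - \<chi>\<^sub>0 y) = 0"
    proof (rule insert.IH[of "\<lambda>\<eta>. a \<eta> * (\<eta> y - \<chi>\<^sub>0 y)"])
      fix x
      have "(\<Sum>\<eta>\<in>S. a \<eta> * (\<eta> y - \<chi>\<^sub>0 y) * \<eta> x)
          = (\<Sum>\<eta>\<in>S. a \<eta> * \<eta> (y * x) - \<chi>\<^sub>0 y * (a \<eta> * \<eta> x))"
        by (intro sum.cong) (auto simp: mult algebra_simps)
      also have "\<dots> = (\<Sum>\<eta>\<in>S. a \<eta> * \<eta> (y * x)) - \<chi>\<^sub>0 y * (\<Sum>\<eta>\<in>S. a \<eta> * \<eta> x)"
        by (simp add: sum_subtractf sum_distrib_left)
      also have "\<dots> = - (a \<chi>\<^sub>0 * \<chi>\<^sub>0 (y * x)) + \<chi>\<^sub>0 y * (a \<chi>\<^sub>0 * \<chi>\<^sub>0 x)"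
        using rel[of "y * x"] rel[of x] by (simp only: eq_neg_iff_add_eq_0[symmetric] add.commute minus_equation_iff) simp
      finally show "(\<Sum>\<eta>\<in>S. a \<eta> * (\<eta> y - \<chi>\<^sub>0 y) * \<eta> x) = 0"
        by (simp add: mult)
    qed (use that insert.prems in auto)
    with y show ?thesis by simp
  qed
  moreover have "a \<chi>\<^sub>0 = 0" using rel[of 1] zero one[of \<chi>\<^sub>0] by simp
  ultimately show ?case using insert.prems(4) by auto
qed

section \<open>Cyclic multiplicative group and counting of roots\<close>

text \<open>The multiplicative group of a finite field is cyclic. The operations of the type are
  packed into a ring record \<open>R\<close> so that the theorem about rings with a carrier
  applies.\<close>

lemma finite_field_primitive_element:
  "\<exists>g::'a::{field,finite}. \<forall>x. x \<noteq> 0 \<longrightarrow> (\<exists>k::nat. x = g ^ k)"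
proof -
  define R :: "'a ring" where "R = \<lparr>carrier = UNIV, mult = (*), one = 1, zero = 0, add = (+)\<rparr>"
  have R: "carrier R = UNIV" "mult R = (*)" "one R = 1" "zero R = 0" "add R = (+)"
    by (simp_all add: R_def)
  have inverse: "\<exists>y. x + y = 0" "x \<noteq> 0 \<Longrightarrow> \<exists>y. x * y = 1" for x :: 'a
    by (auto intro: exI[of _ "- x"] exI[of _ "inverse x"])
  interpret field R
    by unfold_locales (auto simp: R Units_def algebra_simps inverse)
  have pow: "x [^]\<^bsub>R\<^esub> k = x ^ k" for x :: 'a and k :: nat
    by (induction k) (auto simp: R nat_pow_def mult.commute)
  obtain g where "carrier (mult_of R) = {g [^]\<^bsub>R\<^esub> i |i::nat. i \<in> UNIV}"
    using finite_field_mult_group_has_gen by (auto simp: R)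
  then have "UNIV - {0} = {g ^ i |i::nat. True}" by (simp add: R pow)
  then show ?thesis by (intro exI[of _ g]) blast
qed

text \<open>The set consists of the roots of X^m - X, which is nonzero of degree m because m > 1
  keeps the two monomials from cancelling.\<close>

lemma card_roots_power_eq_self:
  fixes m :: nat
  assumes "m > 1"
  shows "card {x::'a::{field,finite}. x ^ m = x} \<le> m"
proof -
  define P where "P = monom (1::'a) m - monom 1 1"
  have "coeff P m = 1" using assms by (simp add: P_def)
  then have "P \<noteq> 0" by auto
  have "{x. x ^ m = x} = {x. poly P x = 0}" by (auto simp: P_def poly_monom)
  also have "card \<dots> \<le> degree P" by (rule card_poly_roots_bound) fact
  also have "\<dots> \<le> m" using assms by (auto simp: P_def intro!: degree_diff_le simp: degree_monom_eq)
  finally show ?thesis .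
qed

lemma is_subfieldD:
  assumes "is_subfield K"
  shows "0 \<in> K" "1 \<in> K" "x \<in> K \<Longrightarrow> y \<in> K \<Longrightarrow> x - y \<in> K" "x \<in> K \<Longrightarrow> y \<in> K \<Longrightarrow> x * y \<in> K"
    "x \<in> K \<Longrightarrow> inverse x \<in> K"
  using assms by (auto simp: is_subfield_def)

text \<open>Multiplication by a nonzero \<open>x\<close> permutes \<open>K - {0}\<close>; comparing
  the products over this set gives \<open>x ^ (card K - 1) = 1\<close>.\<close>

lemma subfield_power_card:
  fixes K :: "'a::{field,finite} set"
  assumes "is_subfield K" "x \<in> K"
  shows "x ^ card K = x"
proof (cases "x = 0")
  case True
  have "card K > 0" using assms by (auto simp: card_gt_0_iff)
  with True show ?thesis by simp
next
  case False
  note K = is_subfieldD[OF assms(1)]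
  have "bij_betw ((*) x) (K - {0}) (K - {0})"
  proof (rule bij_betw_byWitness[where f' = "(*) (inverse x)"])
  qed (use K False assms(2) in auto)
  then have "prod (\<lambda>y. x * y) (K - {0}) = prod (\<lambda>y. y) (K - {0})"
    using prod.reindex_bij_betw[of "(*) x" "K - {0}" "K - {0}" "\<lambda>y. y"] by simp
  then have "x ^ card (K - {0}) * \<Prod>(K - {0}) = \<Prod>(K - {0})"
    by (simp add: prod.distrib)
  moreover have "\<Prod>(K - {0}) \<noteq> 0" by simp
  ultimately have "x ^ card (K - {0}) = 1" by simp
  moreover have "card K = Suc (card (K - {0}))" using K by (metis card.remove finite)
  ultimately show ?thesis by simp
qed

section \<open>The Galois group, its order and its generators\<close>

lemma frobenius_in_Gal:
  fixes K :: "'a::{field,finite} set"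
  assumes "primepow q" "is_subfield K" "card K = q" "card (UNIV :: 'a set) = q ^ n"
  shows "(\<lambda>x. x ^ q) \<in> Gal K"
proof -
  obtain p k where p: "Factorial_Ring.prime p" "q = p ^ k" using assms(1) by (auto simp: primepow_def)
  have CHAR: "Factorial_Ring.prime CHAR('a)"
    using prime_CHAR_semidom[where ?'a = 'a] finite_imp_CHAR_pos[where ?'a = 'a] by simp
  \<comment> \<open>The characteristic is a prime dividing the order \<open>p ^ (k * n)\<close> of
    the field, so it is \<open>p\<close>. Hence \<open>q\<close> is a power of the characteristic,
    and raising to the power \<open>q\<close> is additive.\<close>
  have "CHAR('a) dvd p ^ (k * n)"
    using CHAR_dvd_CARD[where ?'a = 'a] assms(4) p by (simp add: power_mult)
  then have "CHAR('a) = p" using CHAR p(1) by (metis prime_dvd_power primes_dvd_imp_eq)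
  then have add: "(x + y) ^ q = x ^ q + y ^ q" for x y :: 'a
    using freshmans_dream'[of q k x y] CHAR p by simp
  have "q > 0" using assms(1) by (metis primepow_gt_Suc_0 less_trans zero_less_Suc)
  have "inj (\<lambda>x::'a. x ^ q)"
  proof (rule injI)
    fix x y :: 'a assume "x ^ q = y ^ q"
    then have "(x - y) ^ q = 0" using add[of "x - y" y] by simp
    then show "x = y" by simp
  qed
  then have "bij (\<lambda>x::'a. x ^ q)" by (simp add: bij_def finite_UNIV_inj_surj)
  then show ?thesis using add subfield_power_card[OF assms(2)] assms(3)
    by (auto simp: Gal_def field_aut_def power_mult_distrib)
qed

lemma funpow_power: "((\<lambda>x::'a::monoid_mult. x ^ q) ^^ i) x = x ^ (q ^ i)"
  by (induction i) (simp_all add: power_mult[symmetric] mult.commute)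

lemma Gal_funpow: "\<tau> \<in> Gal K \<Longrightarrow> \<tau> ^^ i \<in> Gal K"
proof -
  assume "\<tau> \<in> Gal K"
  moreover have "(\<tau> ^^ i) x = x" if "\<tau> x = x" for x using that by (induction i) auto
  ultimately show ?thesis by (auto simp: Gal_def field_aut_funpow)
qed

text \<open>Cancelling \<open>f ^^ i\<close> from \<open>f ^^ i = f ^^ j\<close> with i < j would
  make \<open>f ^^ (j - i)\<close> the identity.\<close>

lemma inj_on_funpow_less:
  assumes "bij f" "\<And>i. 0 < i \<Longrightarrow> i < n \<Longrightarrow> f ^^ i \<noteq> id"
  shows "inj_on (\<lambda>i. f ^^ i) {..<n}"
proof (rule linorder_inj_onI)
  fix i j assume ij: "i < j" "i \<in> {..<n}" "j \<in> {..<n}"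
  show "f ^^ i \<noteq> f ^^ j"
  proof
    assume "f ^^ i = f ^^ j"
    also have "f ^^ j = f ^^ i \<circ> f ^^ (j - i)" using ij by (simp flip: funpow_add)
    finally have "(f ^^ i) x = (f ^^ i) ((f ^^ (j - i)) x)" for x by (simp add: fun_eq_iff)
    moreover have "inj (f ^^ i)" using assms(1) by (simp add: inj_fn bij_is_inj)
    ultimately have "f ^^ (j - i) = id" by (metis injD eq_id_iff)
    then show False using assms(2)[of "j - i"] ij by (simp add: less_imp_diff_less)
  qed
qed auto

text \<open>By the pigeonhole principle, two of the \<open>q ^ Suc n\<close> polynomials over
  \<open>K\<close> of degree at most \<open>n\<close> agree at a primitive element \<open>g\<close>.
  Their difference \<open>P\<close> is nonzero and vanishes at \<open>g\<close>, hence at all images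
  of \<open>g\<close> under the group, and it has at most \<open>n\<close> roots.\<close>

lemma card_Gal_le:
  fixes K :: "'a::{field,finite} set"
  assumes "is_subfield K" "card K = q" "q > 1" "card (UNIV :: 'a set) = q ^ n"
  shows "card (Gal K) \<le> n"
proof -
  note K = is_subfieldD[OF assms(1)]
  obtain g :: 'a where g: "\<And>x. x \<noteq> 0 \<Longrightarrow> \<exists>k::nat. x = g ^ k"
    using finite_field_primitive_element by blast
  define ev where "ev a = (\<Sum>i\<le>n. a i * g ^ i)" for a :: "nat \<Rightarrow> 'a"
  define A where "A = PiE {..n} (\<lambda>_. K)"
  have "card A = q ^ Suc n" by (simp add: A_def card_PiE assms)
  then have "card (UNIV :: 'a set) < card A" using assms by simp
  then have "\<not> inj_on ev A"
    by (metis (no_types, lifting) card_inj_on_le finite linorder_not_less subset_UNIV)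
  then obtain a b where ab: "a \<in> A" "b \<in> A" "a \<noteq> b" "ev a = ev b" by (auto simp: inj_on_def)
  define P where "P = (\<Sum>i\<le>n. monom (a i - b i) i)"
  have coeff: "coeff P i = (if i \<le> n then a i - b i else 0)" for i
    by (simp add: P_def coeff_sum sum.delta if_distrib)
  have "P \<noteq> 0"
  proof
    assume "P = 0"
    then have "a i = b i" if "i \<le> n" for i using coeff[of i] that by simp
    then have "a = b" using ab by (auto simp: A_def intro: PiE_ext)
    with ab show False by simp
  qed
  have "degree P \<le> n" by (rule degree_le) (simp add: coeff)
  have ev: "poly P x = (\<Sum>i\<le>n. (a i - b i) * x ^ i)" for x
    by (simp add: P_def poly_sum poly_monom)
  have "poly P (\<tau> g) = 0" if "\<tau> \<in> Gal K" for \<tau>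
  proof -
    have \<tau>: "field_aut \<tau>" and fixed: "\<And>x. x \<in> K \<Longrightarrow> \<tau> x = x" using that by (auto simp: Gal_def)
    have pow: "\<tau> (x ^ i) = \<tau> x ^ i" for x i by (induction i) (auto simp: field_autD[OF \<tau>])
    have sum: "\<tau> (\<Sum>i\<in>I. f i) = (\<Sum>i\<in>I. \<tau> (f i))" for f and I :: "nat set"
      by (induction I rule: infinite_finite_induct) (auto simp: field_autD[OF \<tau>])
    have "poly P (\<tau> g) = (\<Sum>i\<le>n. \<tau> ((a i - b i) * g ^ i))"
      unfolding ev by (intro sum.cong)
        (use ab in \<open>auto simp: field_autD[OF \<tau>] pow fixed A_def PiE_iff\<close>)
    also have "\<dots> = \<tau> (\<Sum>i\<le>n. (a i - b i) * g ^ i)" by (simp add: sum)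
    also have "(\<Sum>i\<le>n. (a i - b i) * g ^ i) = 0"
      using ab by (simp add: ev_def left_diff_distrib sum_subtractf)
    finally show ?thesis by (simp add: field_autD[OF \<tau>])
  qed
  then have "(\<lambda>\<tau>. \<tau> g) ` Gal K \<subseteq> {x. poly P x = 0}" by auto
  \<comment> \<open>Every nonzero element is a power of \<open>g\<close>, so an automorphism is
    determined by its value at \<open>g\<close>.\<close>
  moreover have "inj_on (\<lambda>\<tau>. \<tau> g) (Gal K)"
  proof (rule inj_onI, rule ext)
    fix \<tau> \<tau>' x assume *: "\<tau> \<in> Gal K" "\<tau>' \<in> Gal K" "\<tau> g = \<tau>' g"
    have pow: "\<upsilon> (x ^ i) = \<upsilon> x ^ i" if "\<upsilon> \<in> Gal K" for \<upsilon> x and i :: nat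
      using that by (induction i) (auto simp: Gal_def field_autD)
    show "\<tau> x = \<tau>' x"
    proof (cases "x = 0")
      case True
      then show ?thesis using * by (auto simp: Gal_def field_autD)
    next
      case False
      then obtain k :: nat where "x = g ^ k" using g by blast
      then show ?thesis by (simp add: pow[OF *(1)] pow[OF *(2)] *(3))
    qed
  qed
  ultimately have "card (Gal K) \<le> card {x. poly P x = 0}" by (metis card_inj_on_le finite)
  also have "\<dots> \<le> degree P" by (rule card_poly_roots_bound) fact
  finally show ?thesis using \<open>degree P \<le> n\<close> by simp
qed

text \<open>The group has exactly \<open>n\<close> elements: \<open>card_Gal_le\<close> bounds it
  above, and the first \<open>n\<close> powers of the Frobenius map are distinct, since
  \<open>x ^ (q ^ i) = x\<close> has at most \<open>q ^ i < q ^ n\<close> solutions. The powers of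
  \<open>\<sigma>\<close> below its order \<open>m\<close> are distinct and exhaust the group, so
  \<open>m = n\<close>.\<close>

lemma Gal_generator_order:
  fixes K :: "'a::{field,finite} set"
  assumes "primepow q" "is_subfield K" "card K = q" "card (UNIV :: 'a set) = q ^ n"
    and "Gal_generator K \<sigma>"
  shows "\<sigma> ^^ n = id" "inj_on (\<lambda>i. \<sigma> ^^ i) {..<n}"
proof -
  let ?\<phi> = "\<lambda>x::'a. x ^ q"
  have q: "q > 1" using assms(1) primepow_gt_Suc_0 by force
  have \<sigma>: "\<sigma> \<in> Gal K" "\<And>\<tau>. \<tau> \<in> Gal K \<Longrightarrow> \<exists>i::nat. \<tau> = \<sigma> ^^ i" "bij \<sigma>"
    using assms(5) by (auto simp: Gal_generator_def Gal_def field_aut_def)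
  have \<phi>: "?\<phi> \<in> Gal K" using frobenius_in_Gal assms by blast
  have "inj_on (\<lambda>i. ?\<phi> ^^ i) {..<n}"
  proof (rule inj_on_funpow_less)
    fix i :: nat assume i: "0 < i" "i < n"
    show "?\<phi> ^^ i \<noteq> id"
    proof
      assume id: "?\<phi> ^^ i = id"
      have "x ^ (q ^ i) = x" for x :: 'a
        using fun_cong[OF id, of x] by (simp only: funpow_power id_apply)
      then have "{x::'a. x ^ (q ^ i) = x} = UNIV" by auto
      then have "q ^ n \<le> q ^ i"
        using card_roots_power_eq_self[of "q ^ i", where ?'a = 'a] assms(4) one_less_power[OF q i(1)] by simp
      then show False using q i by simp
    qed
  qed (use \<phi> in \<open>simp add: Gal_def field_aut_def\<close>)
  moreover have "(\<lambda>i. ?\<phi> ^^ i) ` {..<n} \<subseteq> Gal K" using Gal_funpow[OF \<phi>] by auto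
  ultimately have ge: "n \<le> card (Gal K)" by (metis card_inj_on_le card_lessThan finite)
  have le: "card (Gal K) \<le> n" using card_Gal_le assms q by blast
  \<comment> \<open>A finite type has finitely many self-maps, so the powers of
    \<open>\<sigma>\<close> repeat and \<open>\<sigma>\<close> has finite order.\<close>
  have "finite (range (\<lambda>i. \<sigma> ^^ i))" by simp
  then have "\<not> inj (\<lambda>i::nat. \<sigma> ^^ i)" using finite_imageD infinite_UNIV_nat by blast
  moreover have "inj (\<lambda>i::nat. \<sigma> ^^ i)" if "\<And>m. m > 0 \<Longrightarrow> \<sigma> ^^ m \<noteq> id"
  proof (rule injI)
    fix i j :: nat assume "\<sigma> ^^ i = \<sigma> ^^ j"
    then show "i = j"
      using inj_on_funpow_less[OF \<sigma>(3), of "Suc (max i j)"] that by (auto dest: inj_onD)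
  qed
  ultimately have "\<exists>m>0. \<sigma> ^^ m = id" by blast
  define m where "m = (LEAST m. m > 0 \<and> \<sigma> ^^ m = id)"
  have m: "m > 0" "\<sigma> ^^ m = id"
    using LeastI_ex[OF \<open>\<exists>m>0. \<sigma> ^^ m = id\<close>] by (auto simp: m_def)
  have inj: "inj_on (\<lambda>i. \<sigma> ^^ i) {..<m}"
    by (rule inj_on_funpow_less) (use \<sigma> not_less_Least in \<open>auto simp: m_def\<close>)
  have "(\<lambda>i. \<sigma> ^^ i) ` {..<m} = Gal K"
  proof
    show "Gal K \<subseteq> (\<lambda>i. \<sigma> ^^ i) ` {..<m}"
    proof
      fix \<tau> assume "\<tau> \<in> Gal K"
      then obtain i where "\<tau> = \<sigma> ^^ i" using \<sigma> by blast
      also have "\<dots> = \<sigma> ^^ (i mod m)" using m by (auto simp: fun_eq_iff funpow_mod_eq)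
      finally show "\<tau> \<in> (\<lambda>i. \<sigma> ^^ i) ` {..<m}" using m by auto
    qed
  qed (use Gal_funpow \<sigma> in auto)
  then have "m = card (Gal K)" using card_image[OF inj] by simp
  then have "m = n" using le ge by simp
  with m inj show "\<sigma> ^^ n = id" "inj_on (\<lambda>i. \<sigma> ^^ i) {..<n}" by auto
qed

text \<open>The Frobenius map is some power \<open>\<sigma> ^^ j\<close>, and powers of
  \<open>\<sigma>\<close> commute. A fixed point of \<open>\<sigma> ^^ i\<close> is therefore fixed
  by the \<open>i\<close>-th power of Frobenius, that is, it is a root of X^(q^i) - X.\<close>

lemma card_fixed_points_funpow_le:
  fixes K :: "'a::{field,finite} set"
  assumes "primepow q" "is_subfield K" "card K = q" "card (UNIV :: 'a set) = q ^ n"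
    and "Gal_generator K \<sigma>" "i > 0"
  shows "card {x. (\<sigma> ^^ i) x = x} \<le> q ^ i"
proof -
  have q: "q > 1" using assms(1) primepow_gt_Suc_0 by force
  obtain j :: nat where j: "(\<lambda>x. x ^ q) = \<sigma> ^^ j"
    using frobenius_in_Gal assms by (metis Gal_generator_def)
  have "x ^ (q ^ i) = x" if "(\<sigma> ^^ i) x = x" for x
  proof -
    have "x ^ (q ^ i) = ((\<sigma> ^^ j) ^^ i) x" by (simp only: j[symmetric] funpow_power)
    also have "\<dots> = ((\<sigma> ^^ i) ^^ j) x" by (simp add: funpow_mult mult.commute)
    also have "\<dots> = x" using that by (induction j) auto
    finally show ?thesis .
  qed
  then have "card {x. (\<sigma> ^^ i) x = x} \<le> card {x::'a. x ^ (q ^ i) = x}"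
    by (intro card_mono) auto
  also have "\<dots> \<le> q ^ i" using q assms(6) by (intro card_roots_power_eq_self one_less_power)
  finally show ?thesis .
qed


section \<open>The right idealiser of the code\<close>

lemma funpow_independence:
  fixes \<sigma> :: "'a::field \<Rightarrow> 'a"
  assumes "field_aut \<sigma>" "inj_on (\<lambda>i. \<sigma> ^^ i) {..<n}"
    and "\<And>x. (\<Sum>i<n. a i * (\<sigma> ^^ i) x) = 0" "i < n"
  shows "a i = 0"
proof -
  \<comment> \<open>The characters are indexed by themselves in
    \<open>dedekind_independence\<close>; \<open>b\<close> carries the coefficient of index
    \<open>i\<close> over to the map \<open>\<sigma> ^^ i\<close>.\<close>
  define b where "b \<chi> = a (the_inv_into {..<n} (\<lambda>i. \<sigma> ^^ i) \<chi>)" for \<chi>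
  have b: "b (\<sigma> ^^ j) = a j" if "j < n" for j
    using that by (simp add: b_def the_inv_into_f_f[OF assms(2)])
  have "b (\<sigma> ^^ i) = 0"
  proof (rule dedekind_independence[where S = "(\<lambda>i. \<sigma> ^^ i) ` {..<n}" and a = b])
    fix x
    have "(\<Sum>\<chi>\<in>(\<lambda>i. \<sigma> ^^ i) ` {..<n}. b \<chi> * \<chi> x) = (\<Sum>i<n. b (\<sigma> ^^ i) * (\<sigma> ^^ i) x)"
      by (simp add: sum.reindex[OF assms(2)])
    also have "\<dots> = 0" using assms(3)[of x] by (simp add: b)
    finally show "(\<Sum>\<chi>\<in>(\<lambda>i. \<sigma> ^^ i) ` {..<n}. b \<chi> * \<chi> x) = 0" .
  qed (use assms(4) in \<open>auto simp: field_autD[OF field_aut_funpow[OF assms(1)]]\<close>)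
  with b assms(4) show ?thesis by simp
qed

text \<open>Since \<open>\<sigma> ^^ n = id\<close>, terms can be collected by exponent modulo
  \<open>n\<close>. Lists of pairs of coefficient and exponent allow repeated and unreduced
  exponents, as they arise from composition.\<close>

lemma funpow_independence_list:
  fixes \<sigma> :: "'a::field \<Rightarrow> 'a"
  assumes "field_aut \<sigma>" "inj_on (\<lambda>i. \<sigma> ^^ i) {..<n}" "\<sigma> ^^ n = id"
    and "\<And>x. (\<Sum>(c, e) \<leftarrow> xs. c * (\<sigma> ^^ e) x) = 0" "k < n"
  shows "(\<Sum>(c, e) \<leftarrow> xs. if e mod n = k then c else 0) = 0"
proof (rule funpow_independence[OF assms(1,2) _ assms(5),
    where a = "\<lambda>k. \<Sum>(c, e) \<leftarrow> xs. if e mod n = k then c else 0"])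
  fix x
  have n: "n > 0" using assms(5) by simp
  have "(\<Sum>i<n. (\<Sum>(c, e) \<leftarrow> xs. if e mod n = i then c else 0) * (\<sigma> ^^ i) x)
      = (\<Sum>(c, e) \<leftarrow> xs. c * (\<sigma> ^^ e) x)"
  proof (induction xs)
    case (Cons p xs)
    obtain c e where p: "p = (c, e)" by force
    have "(\<Sum>i<n. (if e mod n = i then c else 0) * (\<sigma> ^^ i) x)
        = (\<Sum>i<n. if e mod n = i then c * (\<sigma> ^^ i) x else 0)"
      by (intro sum.cong) auto
    also have "\<dots> = c * (\<sigma> ^^ (e mod n)) x" using n by (simp add: sum.delta)
    also have "\<dots> = c * (\<sigma> ^^ e) x" using assms(3) by (simp add: funpow_mod_eq)
    finally show ?case using Cons.IH by (simp add: p distrib_right sum.distrib)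
  qed simp
  then show "(\<Sum>i<n. (\<Sum>(c, e) \<leftarrow> xs. if e mod n = i then c else 0) * (\<sigma> ^^ i) x) = 0"
    using assms(4) by simp
qed

section \<open>Composition of quadrinomials\<close>

text \<open>This is \<open>psi\<close> with its last two coefficients freed, so that the family is
  closed under applying a field automorphism to the coefficients.\<close>

definition quadrinomial :: "('a::field \<Rightarrow> 'a) \<Rightarrow> nat \<Rightarrow> 'a \<Rightarrow> 'a \<Rightarrow> 'a \<Rightarrow> 'a" where
  "quadrinomial \<sigma> t c d x =
     \<sigma> x + (\<sigma> ^^ (t - 1)) x + c * (\<sigma> ^^ (t + 1)) x + d * (\<sigma> ^^ (2 * t - 1)) x"

text \<open>Modulo \<open>2 * t\<close> the exponents of \<open>\<sigma>\<close> in the composition of two quadrinomials are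
  \<open>0\<close>, \<open>2\<close>, \<open>t - 2\<close>, \<open>t\<close>, \<open>t + 2\<close>, \<open>2 * t - 2\<close>, which for \<open>t \<ge> 5\<close> differ from
  the exponents of a quadrinomial. Hence \<open>\<alpha>\<close> and \<open>\<beta>\<close> are constrained separately.\<close>

lemma quadrinomial_right_idealiser:
  fixes \<sigma> :: "'a::field \<Rightarrow> 'a"
  assumes \<sigma>: "field_aut \<sigma>" "inj_on (\<lambda>i. \<sigma> ^^ i) {..<2 * t}" "\<sigma> ^^ (2 * t) = id"
    and t: "t \<ge> 5" and c: "c \<noteq> 0"
    and eq: "\<And>x. quadrinomial \<sigma> t c d (\<alpha> * x + \<beta> * quadrinomial \<sigma> t c d x)
              = \<alpha>' * x + \<beta>' * quadrinomial \<sigma> t c d x"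
  shows "(\<sigma> ^^ 2) \<alpha> = \<alpha>"
    and "\<sigma> \<beta> + c * (\<sigma> ^^ (t + 1)) c * (\<sigma> ^^ (t + 1)) \<beta> = 0"
proof -
  \<comment> \<open>This turns the truncated differences \<open>t - 1\<close> and
    \<open>2 * t - 1\<close> into the sums \<open>s + 4\<close> and
    \<open>2 * s + 9\<close>.\<close>
  obtain s where s: "t = s + 5" using t le_Suc_ex[of 5 t] by (auto simp: add.commute)
  note aut = field_autD[OF field_aut_funpow[OF \<sigma>(1)]]
  \<comment> \<open>\<open>T a i j c'\<close> is the term that results from applying
    \<open>a * (\<sigma> ^^ i) _\<close> to \<open>c' * (\<sigma> ^^ j) x\<close>. Accordingly
    \<open>row a i\<close> expands
    \<open>a * (\<sigma> ^^ i) (\<alpha> * x + \<beta> * P x)\<close>, and \<open>xs\<close> expands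
    the difference of the two sides of \<open>eq\<close>.\<close>
  define T where "T a i j c' = (a * (\<sigma> ^^ i) c', i + j)" for a c' :: 'a and i j :: nat
  define row where "row a i = [T a i 0 \<alpha>, T a i 1 \<beta>, T a i (s + 4) \<beta>,
    T a i (s + 6) (\<beta> * c), T a i (2 * s + 9) (\<beta> * d)]" for a :: 'a and i :: nat
  define xs where "xs = row 1 1 @ row 1 (s + 4) @ row c (s + 6) @ row d (2 * s + 9)
    @ [(- \<alpha>', 0), (- \<beta>', 1), (- \<beta>', s + 4), (- \<beta>' * c, s + 6), (- \<beta>' * d, 2 * s + 9)]"
  define P where "P = quadrinomial \<sigma> t c d"
  have P: "P x = (\<sigma> ^^ 1) x + (\<sigma> ^^ (s + 4)) x + c * (\<sigma> ^^ (s + 6)) x + d * (\<sigma> ^^ (2 * s + 9)) x" for x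
  proof -
    have exponents: "t - 1 = s + 4" "t + 1 = s + 6" "2 * t - 1 = 2 * s + 9" using s by auto
    show ?thesis unfolding P_def quadrinomial_def exponents by simp
  qed
  have row: "(\<Sum>(c, e) \<leftarrow> row a i. c * (\<sigma> ^^ e) x) = a * (\<sigma> ^^ i) (\<alpha> * x + \<beta> * P x)" for a i x
    unfolding row_def T_def P
    by (simp only: list.map sum_list.Cons sum_list.Nil prod.case aut funpow_add comp_apply
        distrib_left mult.assoc add.assoc add_0_right funpow_0 funpow.simps id_apply)
  have rel: "(\<Sum>(c, e) \<leftarrow> xs. c * (\<sigma> ^^ e) x) = 0" for x
  proof -
    have "(\<Sum>(c, e) \<leftarrow> xs. c * (\<sigma> ^^ e) x) = P (\<alpha> * x + \<beta> * P x) - (\<alpha>' * x + \<beta>' * P x)"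
      unfolding xs_def map_append sum_list_append row P[of "\<alpha> * x + \<beta> * P x"]
      by (simp add: P algebra_simps)
    then show ?thesis using eq[of x] by (simp add: P_def)
  qed
  have n: "2 * t = 2 * s + 10" using s by simp
  have coeff: "(\<Sum>(c, e) \<leftarrow> xs. if e mod (2 * s + 10) = k then c else 0) = 0" if "k < 2 * s + 10" for k
    using funpow_independence_list[OF \<sigma> rel, of k] that by (simp add: n)
  \<comment> \<open>No exponent in \<open>xs\<close> exceeds \<open>4 * s + 18\<close>, so one
    subtraction reduces it.\<close>
  have mod: "e mod (2 * s + 10) = (if e < 2 * s + 10 then e else e - (2 * s + 10))"
    if "e < 4 * s + 20" for e
    using that by (auto simp: mod_if)
  \<comment> \<open>At the exponents t - 1 and t + 1 the left side of \<open>eq\<close> contributes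
    only terms in \<alpha>, so both coefficients express \<open>\<beta>'\<close> through
    \<alpha>.\<close>
  have "(\<sigma> ^^ (s + 4)) \<alpha> = \<beta>'"
    using coeff[of "s + 4"] by (simp add: xs_def row_def T_def mod)
  moreover have "c * (\<sigma> ^^ (s + 6)) \<alpha> = \<beta>' * c"
    using coeff[of "s + 6"] by (simp add: xs_def row_def T_def mod)
  ultimately have *: "(\<sigma> ^^ (s + 4)) \<alpha> = (\<sigma> ^^ (s + 6)) \<alpha>" using c by auto
  have "(\<sigma> ^^ (s + 4)) ((\<sigma> ^^ 2) \<alpha>) = (\<sigma> ^^ (s + 4 + 2)) \<alpha>"
    by (simp only: funpow_add comp_apply)
  also have "s + 4 + 2 = s + 6" by simp
  finally have "(\<sigma> ^^ (s + 4)) ((\<sigma> ^^ 2) \<alpha>) = (\<sigma> ^^ (s + 4)) \<alpha>" using * by simp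
  then show "(\<sigma> ^^ 2) \<alpha> = \<alpha>" using aut(9) by (metis injD)
  \<comment> \<open>Modulo 2t the exponent 2 arises only as 1 + 1 and as (t + 1) + (t + 1), and the
    right side of \<open>eq\<close> has no such term.\<close>
  have "\<sigma> \<beta> + c * (\<sigma> ^^ (s + 6)) (\<beta> * c) = 0"
    using coeff[of 2] by (simp add: xs_def row_def T_def mod)
  moreover have "t + 1 = s + 6" using s by simp
  ultimately show "\<sigma> \<beta> + c * (\<sigma> ^^ (t + 1)) c * (\<sigma> ^^ (t + 1)) \<beta> = 0"
    by (simp only: aut) (simp only: ac_simps)
qed

text \<open>Dividing the equation for \<beta> by that for a nonzero solution
  \<open>\<beta>\<^sub>0\<close> cancels \<gamma> and shows that the quotient is fixed by
  \<open>g\<close>. So the solutions lie in a multiple of the fixed field of \<open>g\<close>, or 0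
  is the only one.\<close>

lemma card_scaled_fixed_points_le:
  fixes f g :: "'a::{field,finite} \<Rightarrow> 'a"
  assumes f: "field_aut f" and g: "field_aut g"
  shows "card {\<beta>. f \<beta> + \<gamma> * f (g \<beta>) = 0} \<le> card {x. g x = x}"
proof (cases "\<exists>\<beta>\<^sub>0. \<beta>\<^sub>0 \<noteq> 0 \<and> f \<beta>\<^sub>0 + \<gamma> * f (g \<beta>\<^sub>0) = 0")
  case True
  then obtain \<beta>\<^sub>0 where \<beta>\<^sub>0: "\<beta>\<^sub>0 \<noteq> 0" "f \<beta>\<^sub>0 + \<gamma> * f (g \<beta>\<^sub>0) = 0" by blast
  have "{\<beta>. f \<beta> + \<gamma> * f (g \<beta>) = 0} \<subseteq> (\<lambda>u. u * \<beta>\<^sub>0) ` {x. g x = x}"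
  proof
    fix \<beta> assume "\<beta> \<in> {\<beta>. f \<beta> + \<gamma> * f (g \<beta>) = 0}"
    then have \<beta>: "f \<beta> = - \<gamma> * f (g \<beta>)" by (simp add: eq_neg_iff_add_eq_0)
    have \<beta>\<^sub>0': "f \<beta>\<^sub>0 = - \<gamma> * f (g \<beta>\<^sub>0)" using \<beta>\<^sub>0 by (simp add: eq_neg_iff_add_eq_0)
    have "f \<beta>\<^sub>0 \<noteq> 0" using \<beta>\<^sub>0 field_autD(8)[OF f] by simp
    then have "\<gamma> \<noteq> 0" "f (g \<beta>\<^sub>0) \<noteq> 0" using \<beta>\<^sub>0' by auto
    then have "f (\<beta> / \<beta>\<^sub>0) = f (g (\<beta> / \<beta>\<^sub>0))"
      using \<beta> \<beta>\<^sub>0' by (simp add: field_autD[OF f] field_autD[OF g])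
    then have "g (\<beta> / \<beta>\<^sub>0) = \<beta> / \<beta>\<^sub>0" using field_autD(9)[OF f] by (metis injD)
    then show "\<beta> \<in> (\<lambda>u. u * \<beta>\<^sub>0) ` {x. g x = x}"
      using \<beta>\<^sub>0(1) by (intro image_eqI[of _ _ "\<beta> / \<beta>\<^sub>0"]) auto
  qed
  then show ?thesis by (meson card_image_le card_mono finite le_trans)
next
  case False
  then have "{\<beta>. f \<beta> + \<gamma> * f (g \<beta>) = 0} \<subseteq> {0}" by auto
  then have "card {\<beta>. f \<beta> + \<gamma> * f (g \<beta>) = 0} \<le> 1" using card_mono[of "{0::'a}"] by simp
  moreover have "0 \<in> {x. g x = x}" by (simp add: field_autD[OF g])
  then have "card {x. g x = x} \<ge> 1" by (metis One_nat_def Suc_leI card_gt_0_iff empty_iff finite)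
  ultimately show ?thesis by simp
qed

section \<open>Field automorphisms acting on the coefficients\<close>

text \<open>A sum of indicators, so that the sigma-polynomial splits into five sums with one term
  each.\<close>

definition quad_coeffs :: "nat \<Rightarrow> 'a::field \<Rightarrow> 'a \<Rightarrow> 'a \<Rightarrow> 'a \<Rightarrow> nat \<Rightarrow> 'a" where
  "quad_coeffs t \<alpha> \<beta> c d i = (if i = 0 then \<alpha> else 0) + (if i = 1 then \<beta> else 0)
     + (if i = t - 1 then \<beta> else 0) + (if i = t + 1 then \<beta> * c else 0)
     + (if i = 2 * t - 1 then \<beta> * d else 0)"

lemma sigma_poly_quad_coeffs:
  assumes "t \<ge> 2"
  shows "sigma_poly \<sigma> (2 * t) (quad_coeffs t \<alpha> \<beta> c d)
    = (\<lambda>x. \<alpha> * x + \<beta> * quadrinomial \<sigma> t c d x)"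
proof
  fix x
  have delta: "(\<Sum>i<2 * t. (if i = k then u else 0) * (\<sigma> ^^ i) x) = u * (\<sigma> ^^ k) x"
    if "k < 2 * t" for k u
  proof -
    have "(\<Sum>i<2 * t. (if i = k then u else 0) * (\<sigma> ^^ i) x)
        = (\<Sum>i<2 * t. if i = k then u * (\<sigma> ^^ i) x else 0)"
      by (intro sum.cong) auto
    then show ?thesis using that by (simp add: sum.delta)
  qed
  show "sigma_poly \<sigma> (2 * t) (quad_coeffs t \<alpha> \<beta> c d) x = \<alpha> * x + \<beta> * quadrinomial \<sigma> t c d x"
    \<comment> \<open>The bound t \<ge> 2 places all five exponents below 2t.\<close>
    using assms unfolding sigma_poly_def quad_coeffs_def distrib_right sum.distrib
    by (subst (1 2 3 4 5) delta) (auto simp: quadrinomial_def algebra_simps)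
qed

lemma field_aut_quad_coeffs:
  assumes "field_aut \<rho>"
  shows "\<rho> (quad_coeffs t \<alpha> \<beta> c d i) = quad_coeffs t (\<rho> \<alpha>) (\<rho> \<beta>) (\<rho> c) (\<rho> d) i"
  by (simp add: quad_coeffs_def field_autD[OF assms] if_distrib[of \<rho>])

definition quad_code :: "('a::field \<Rightarrow> 'a) \<Rightarrow> nat \<Rightarrow> 'a \<Rightarrow> 'a \<Rightarrow> ('a \<Rightarrow> 'a) set" where
  "quad_code \<sigma> t c d = {(\<lambda>x. \<alpha> * x + \<beta> * quadrinomial \<sigma> t c d x) | \<alpha> \<beta>. True}"

text \<open>Eliminates \<rho> from \<open>code_equiv\<close> by moving it into \<open>c\<close> and
  \<open>d\<close>; \<open>F\<close> stands for the composition with the two invertible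
  maps.\<close>

lemma quad_code_field_aut:
  fixes \<sigma> :: "'a::field \<Rightarrow> 'a"
  assumes \<sigma>: "field_aut \<sigma>" "inj_on (\<lambda>i. \<sigma> ^^ i) {..<2 * t}" and t: "t \<ge> 2" and \<rho>: "field_aut \<rho>"
  shows "{F (sigma_poly \<sigma> (2 * t) (\<rho> \<circ> a)) |a. sigma_poly \<sigma> (2 * t) a \<in> quad_code \<sigma> t c d}
    = F ` quad_code \<sigma> t (\<rho> c) (\<rho> d)"
proof (intro equalityI subsetI)
  fix f assume "f \<in> {F (sigma_poly \<sigma> (2 * t) (\<rho> \<circ> a)) |a. sigma_poly \<sigma> (2 * t) a \<in> quad_code \<sigma> t c d}"
  then obtain a \<alpha> \<beta> where f: "f = F (sigma_poly \<sigma> (2 * t) (\<rho> \<circ> a))"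
    and a: "sigma_poly \<sigma> (2 * t) a = sigma_poly \<sigma> (2 * t) (quad_coeffs t \<alpha> \<beta> c d)"
    by (auto simp: quad_code_def sigma_poly_quad_coeffs[OF t])
  \<comment> \<open>The function \<open>a\<close> is any representation of a codeword; independence
    of the powers of \<open>\<sigma>\<close> forces its coefficients below 2t, so
    \<open>\<rho> \<circ> a\<close> yields a well-defined map.\<close>
  have "a i - quad_coeffs t \<alpha> \<beta> c d i = 0" if "i < 2 * t" for i
  proof (rule funpow_independence[OF \<sigma> _ that, where a = "\<lambda>i. a i - quad_coeffs t \<alpha> \<beta> c d i"])
    show "(\<Sum>i<2 * t. (a i - quad_coeffs t \<alpha> \<beta> c d i) * (\<sigma> ^^ i) x) = 0" for x
      using fun_cong[OF a, of x] by (simp add: sigma_poly_def left_diff_distrib sum_subtractf)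
  qed
  then have "sigma_poly \<sigma> (2 * t) (\<rho> \<circ> a)
      = sigma_poly \<sigma> (2 * t) (quad_coeffs t (\<rho> \<alpha>) (\<rho> \<beta>) (\<rho> c) (\<rho> d))"
    by (auto simp: sigma_poly_def fun_eq_iff field_aut_quad_coeffs[OF \<rho>] intro!: sum.cong)
  then show "f \<in> F ` quad_code \<sigma> t (\<rho> c) (\<rho> d)"
    unfolding f by (auto simp: quad_code_def sigma_poly_quad_coeffs[OF t])
next
  fix f assume "f \<in> F ` quad_code \<sigma> t (\<rho> c) (\<rho> d)"
  then obtain \<alpha> \<beta> where f: "f = F (\<lambda>x. \<alpha> * x + \<beta> * quadrinomial \<sigma> t (\<rho> c) (\<rho> d) x)"
    by (auto simp: quad_code_def)
  obtain \<alpha>' \<beta>' where "\<alpha> = \<rho> \<alpha>'" "\<beta> = \<rho> \<beta>'"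
    using field_autD(1)[OF \<rho>] by (metis bij_pointE)
  then have "f = F (sigma_poly \<sigma> (2 * t) (\<rho> \<circ> quad_coeffs t \<alpha>' \<beta>' c d))"
    unfolding f comp_def field_aut_quad_coeffs[OF \<rho>] sigma_poly_quad_coeffs[OF t] by simp
  moreover have "sigma_poly \<sigma> (2 * t) (quad_coeffs t \<alpha>' \<beta>' c d) \<in> quad_code \<sigma> t c d"
    by (auto simp: quad_code_def sigma_poly_quad_coeffs[OF t])
  ultimately show "f \<in> {F (sigma_poly \<sigma> (2 * t) (\<rho> \<circ> a)) |a. sigma_poly \<sigma> (2 * t) a \<in> quad_code \<sigma> t c d}"
    by blast
qed

lemma code_h_eq_quad_code:
  "code_h h t \<sigma> = quad_code \<sigma> t (h * \<sigma> h) (h * inv_into UNIV \<sigma> (inverse h))"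
  by (simp add: code_h_def left_span_pair quad_code_def psi_def quadrinomial_def)

section \<open>Comparison of the right idealisers\<close>

text \<open>As \<theta> is multiplicative, scaling the argument by \<open>c\<close> only multiplies
  the two coefficients by \<open>c\<close> and \<open>\<theta> c\<close>.\<close>

lemma gabidulin2_comp_scale:
  assumes "field_aut \<theta>" "f \<in> gabidulin2 \<theta>"
  shows "f \<circ> (*) c \<in> gabidulin2 \<theta>"
proof -
  obtain a b where "f = (\<lambda>x. a * x + b * \<theta> x)"
    using assms(2) by (auto simp: gabidulin2_def left_span_pair)
  then have "f \<circ> (*) c = (\<lambda>x. (a * c) * x + (b * \<theta> c) * \<theta> x)"
    by (auto simp: field_autD[OF assms(1)] algebra_simps)
  then show ?thesis by (auto simp: gabidulin2_def left_span_pair)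
qed

theorem proposition4p2:
  fixes K :: "'a::{field,finite} set"
    and q n t :: nat
    and \<sigma> \<theta> :: "'a \<Rightarrow> 'a"
    and h :: 'a
  assumes "primepow q" and "odd q"
    and "n = 2 * t" and "t \<ge> 5"
    and "is_subfield K" and "card K = q" and "card (UNIV :: 'a set) = q ^ n"
    and "Gal_generator K \<sigma>" and "Gal_generator K \<theta>"
    and "(\<sigma> ^^ t) h * h = - 1"
  shows "\<not> code_equiv \<sigma> n (gabidulin2 \<theta>) (code_h h t \<sigma>)"
proof
  assume "code_equiv \<sigma> n (gabidulin2 \<theta>) (code_h h t \<sigma>)"
  then obtain f\<^sub>1 f\<^sub>2 \<rho> where inv: "invertible_sigma_poly \<sigma> n f\<^sub>1" "invertible_sigma_poly \<sigma> n f\<^sub>2"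
    and \<rho>: "field_aut \<rho>"
    and G: "gabidulin2 \<theta> = {f\<^sub>1 \<circ> sigma_poly \<sigma> n (\<rho> \<circ> a) \<circ> f\<^sub>2 | a. sigma_poly \<sigma> n a \<in> code_h h t \<sigma>}"
    by (auto simp: code_equiv_def)
  have q: "q > 1" using assms(1) primepow_gt_Suc_0 by force
  have aut: "field_aut \<sigma>" "field_aut \<theta>" using assms(8,9) by (auto simp: Gal_generator_def Gal_def)
  have order: "inj_on (\<lambda>i. \<sigma> ^^ i) {..<2 * t}" "\<sigma> ^^ (2 * t) = id"
    using Gal_generator_order assms by blast+
  define c d where "c = \<rho> (h * \<sigma> h)" and "d = \<rho> (h * inv_into UNIV \<sigma> (inverse h))"
  have "h \<noteq> 0" using assms(10) by auto
  then have c: "c \<noteq> 0" by (simp add: c_def field_autD[OF \<rho>] field_autD[OF aut(1)])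
  define C where "C = quad_code \<sigma> t c d"
  define P where "P = quadrinomial \<sigma> t c d"
  have C_iff: "f \<in> C \<longleftrightarrow> (\<exists>\<alpha> \<beta>. f = (\<lambda>x. \<alpha> * x + \<beta> * P x))" for f
    by (auto simp: C_def P_def quad_code_def)
  have G: "gabidulin2 \<theta> = (\<lambda>f. f\<^sub>1 \<circ> f \<circ> f\<^sub>2) ` C"
    using G quad_code_field_aut[OF aut(1) order(1) _ \<rho>, of "\<lambda>f. f\<^sub>1 \<circ> f \<circ> f\<^sub>2"] assms(3,4)
    by (simp add: code_h_eq_quad_code C_def c_def d_def)
  obtain g\<^sub>1 g\<^sub>2 where g: "g\<^sub>1 \<circ> f\<^sub>1 = id" "f\<^sub>2 \<circ> g\<^sub>2 = id" "g\<^sub>2 \<circ> f\<^sub>2 = id"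
    using inv by (auto simp: invertible_sigma_poly_def)
  \<comment> \<open>Conjugation by \<open>f\<^sub>2\<close> carries the scalar multiplications,
    which lie in the right idealiser of the Gabidulin code, into that of \<open>C\<close>.\<close>
  define E where "E k = f\<^sub>2 \<circ> (*) k \<circ> g\<^sub>2" for k
  have "inj E"
  proof (rule injI)
    fix k l assume "E k = E l"
    then have "g\<^sub>2 \<circ> E k \<circ> f\<^sub>2 = g\<^sub>2 \<circ> E l \<circ> f\<^sub>2" by simp
    moreover have "g\<^sub>2 \<circ> E k \<circ> f\<^sub>2 = (g\<^sub>2 \<circ> f\<^sub>2) \<circ> (*) k \<circ> (g\<^sub>2 \<circ> f\<^sub>2)" for k
      by (simp add: E_def comp_assoc)
    ultimately have "(*) k = (*) l" by (simp add: g)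
    from fun_cong[OF this, of 1] show "k = l" by simp
  qed
  have E: "f \<circ> E k \<in> C" if "f \<in> C" for f k
  proof -
    have "f\<^sub>1 \<circ> f \<circ> f\<^sub>2 \<circ> (*) k \<in> gabidulin2 \<theta>"
      using that G gabidulin2_comp_scale[OF aut(2)] by blast
    then obtain f' where f': "f' \<in> C" "f\<^sub>1 \<circ> f \<circ> f\<^sub>2 \<circ> (*) k = f\<^sub>1 \<circ> f' \<circ> f\<^sub>2" using G by auto
    have "f \<circ> E k = (g\<^sub>1 \<circ> f\<^sub>1) \<circ> f \<circ> f\<^sub>2 \<circ> (*) k \<circ> g\<^sub>2" by (simp add: g E_def comp_assoc)
    also have "\<dots> = g\<^sub>1 \<circ> (f\<^sub>1 \<circ> f \<circ> f\<^sub>2 \<circ> (*) k) \<circ> g\<^sub>2" by (simp add: comp_assoc)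
    also have "\<dots> = (g\<^sub>1 \<circ> f\<^sub>1) \<circ> f' \<circ> (f\<^sub>2 \<circ> g\<^sub>2)" by (subst f'(2)) (simp only: comp_assoc)
    finally show ?thesis using f'(1) by (simp add: g)
  qed
  define \<gamma> where "\<gamma> = c * (\<sigma> ^^ (t + 1)) c"
  define A where "A = {\<alpha>. (\<sigma> ^^ 2) \<alpha> = \<alpha>}"
  \<comment> \<open>Splitting \<open>\<sigma> ^^ (t + 1)\<close> into \<open>\<sigma>\<close> after
    \<open>\<sigma> ^^ t\<close> gives the shape counted by
    \<open>card_scaled_fixed_points_le\<close>.\<close>
  define B where "B = {\<beta>. \<sigma> \<beta> + \<gamma> * \<sigma> ((\<sigma> ^^ t) \<beta>) = 0}"
  have "range E \<subseteq> (\<lambda>(\<alpha>, \<beta>) x. \<alpha> * x + \<beta> * P x) ` (A \<times> B)"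
  proof
    fix e assume "e \<in> range E"
    then obtain k where e: "e = E k" by auto
    \<comment> \<open>Applied to the identity, stability shows that \<open>E k\<close> is itself a
      codeword with coordinates \<alpha> and \<beta>; applied to \<open>P\<close>, it gives the
      equation that constrains them.\<close>
    have "(\<lambda>x. x) \<in> C" unfolding C_iff by (intro exI[of _ 1] exI[of _ 0]) simp
    from E[OF this, of k] obtain \<alpha> \<beta> where \<alpha>\<beta>: "e = (\<lambda>x. \<alpha> * x + \<beta> * P x)"
      by (auto simp: C_iff e comp_def)
    have "P \<in> C" unfolding C_iff by (intro exI[of _ 0] exI[of _ 1]) simp
    from E[OF this, of k] obtain \<alpha>' \<beta>' where "P \<circ> e = (\<lambda>x. \<alpha>' * x + \<beta>' * P x)"
      by (auto simp: C_iff e)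
    then have "P (\<alpha> * x + \<beta> * P x) = \<alpha>' * x + \<beta>' * P x" for x
      by (simp add: \<alpha>\<beta> fun_eq_iff)
    then have "\<alpha> \<in> A" "\<beta> \<in> B"
      using quadrinomial_right_idealiser[OF aut(1) order assms(4) c, of d \<alpha> \<beta> \<alpha>' \<beta>']
      by (auto simp: P_def A_def B_def \<gamma>_def)
    then show "e \<in> (\<lambda>(\<alpha>, \<beta>) x. \<alpha> * x + \<beta> * P x) ` (A \<times> B)" using \<alpha>\<beta> by force
  qed
  then have "card (range E) \<le> card (A \<times> B)"
    by (meson card_image_le card_mono finite le_trans)
  then have "q ^ (2 * t) \<le> card A * card B"
    using card_image[OF \<open>inj E\<close>] assms(3,7) by (simp add: card_cartesian_product)
  also have "card A * card B \<le> q ^ 2 * q ^ t"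
  proof (rule mult_le_mono)
    note fixed = card_fixed_points_funpow_le[OF assms(1,5,6,7,8)]
    show "card A \<le> q ^ 2" unfolding A_def by (rule fixed) simp
    have "card B \<le> card {x. (\<sigma> ^^ t) x = x}"
      unfolding B_def by (rule card_scaled_fixed_points_le) (use aut field_aut_funpow in auto)
    also have "\<dots> \<le> q ^ t" by (rule fixed) (use assms(4) in simp)
    finally show "card B \<le> q ^ t" .
  qed
  also have "\<dots> = q ^ (2 + t)" by (simp only: power_add)
  \<comment> \<open>Strict because 2 + t < 2t for t \<ge> 5.\<close>
  also have "\<dots> < q ^ (2 * t)" using q assms(4) by (intro power_strict_increasing) auto
  finally show False by simp
qed

end
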